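(* Consider a partially observed linear causal model with $\Omega_{\epsilon_{\mathbf L}}=I$. If a set $\mathbf L'$ of latent variables with $|\mathbf L'|\ge 2$ is such that all variables in $\mathbf L'$ have the same parents and the same children in $\mathcal G$, then there must exist orthogonal transformation indeterminacy regarding the edge coefficients $F$. In other words, $F$ can at most be identified up to orthogonal transformation indeterminacy.
   Context: Partially observed linear causal model: Let $\mathcal G$ be a DAG on $m+n$ variables $\mathbf V=\mathbf L\cup\mathbf X$, with $m$ latent variables $\mathbf L$ and $n$ observed variables $\mathbf X$. Each variable satisfies $V_i=\sum_{V_j\in \mathrm{Pa}_{\mathcal G}(V_i)} f_{j,i}V_j+\epsilon_{V_i}$ with independent Gaussian noise terms; in matrix form $\mathbf V=F^T\mathbf V+\epsilon_{\mathbf V}$, where $F=(f_{j,i})$ and $f_{j,i}\ne 0$ if and only if $V_j$ is a parent of $V_i$ in $\mathcal G$. $F$ has blocks $F_{\mathbf L\mathbf L},F_{\mathbf L\mathbf X},F_{\mathbf X\mathbf L},F_{\mathbf X\mathbf X}$ (rows: source, columns: target), and $\Omega=\mathrm{diag}(\Omega_{\epsilon_{\mathbf L}},\Omega_{\epsilon_{\mathbf X}})$ is the diagonal covariance of $\epsilon_{\mathbf V}$. The entailed observations are $\Sigma_{\mathbf X}$, the $\mathbf X$-block of $(I-F)^{-T}\Omega(I-F)^{-1}$. Orthogonal transformation indeterminacy: for a model with $m\ge1$ latent variables and $\Omega_{\epsilon_{\mathbf L}}=I$, it is said to exist if there is a non-diagonal orthogonal $m\times m$ matrix $Q$ such that $(F_{\mathbf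 L\mathbf L},F_{\mathbf L\mathbf X},F_{\mathbf X\mathbf L},F_{\mathbf X\mathbf X},\Omega_{\epsilon_{\mathbf L}},\Omega_{\epsilon_{\mathbf X}})$ and $(\tilde F_{\mathbf L\mathbf L},\tilde F_{\mathbf L\mathbf X},\tilde F_{\mathbf X\mathbf L},\tilde F_{\mathbf X\mathbf X},\tilde\Omega_{\epsilon_{\mathbf L}},\tilde\Omega_{\epsilon_{\mathbf X}})$ share the same support (same pattern of nonzero entries) and entail the same observations $\Sigma_{\mathbf X}$, where $$\tilde F_{\mathbf L\mathbf L}=Q^TF_{\mathbf L\mathbf L}Q,\ \tilde F_{\mathbf L\mathbf X}=Q^TF_{\mathbf L\mathbf X},\ \tilde F_{\mathbf X\mathbf L}=F_{\mathbf X\mathbf L}Q,\ \tilde F_{\mathbf X\mathbf X}=F_{\mathbf X\mathbf X},\ \tilde\Omega_{\epsilon_{\mathbf L}}=\Omega_{\epsilon_{\mathbf L}}=I,\ \tilde\Omega_{\epsilon_{\mathbf X}}=\Omega_{\epsilon_{\mathbf X}}.$$ *)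

theory Defs
  imports "HOL-Probability.Probability"
begin

text \<open>
  The latent variables are indexed by the type \<open>'l\<close>, the observed ones by \<open>'x\<close>, and
  \<open>'l + 'x\<close> indexes all variables. A directed graph is its edge relation:
  \<open>(j, i) \<in> G\<close> means \<open>j \<rightarrow> i\<close>. In all coefficient matrices rows are sources and columns
  are targets, so \<open>F $ j $ i\<close> is the coefficient \<open>f\<^sub>j\<^sub>,\<^sub>i\<close>.
\<close>

definition parents :: "'v rel \<Rightarrow> 'v \<Rightarrow> 'v set" where
  "parents G i = {j. (j, i) \<in> G}"

definition children :: "'v rel \<Rightarrow> 'v \<Rightarrow> 'v set" where
  "children G i = {k. (i, k) \<in> G}"

record ('l, 'x) params =
  F_LL :: "real ^ 'l ^ 'l"
  F_LX :: "real ^ 'x ^ 'l"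
  F_XL :: "real ^ 'l ^ 'x"
  F_XX :: "real ^ 'x ^ 'x"
  Omega_L :: "real ^ 'l ^ 'l"
  Omega_X :: "real ^ 'x ^ 'x"

definition block_matrix ::
  "real ^ 'l ^ 'l \<Rightarrow> real ^ 'x ^ 'l \<Rightarrow> real ^ 'l ^ 'x \<Rightarrow> real ^ 'x ^ 'x
    \<Rightarrow> real ^ ('l::finite + 'x::finite) ^ ('l + 'x)" where
  "block_matrix A B C D = (\<chi> i j.
     (case (i, j) of
        (Inl a, Inl b) \<Rightarrow> A $ a $ b
      | (Inl a, Inr b) \<Rightarrow> B $ a $ b
      | (Inr a, Inl b) \<Rightarrow> C $ a $ b
      | (Inr a, Inr b) \<Rightarrow> D $ a $ b))"

definition edge_matrix :: "('l::finite, 'x::finite) params \<Rightarrow> real ^ ('l + 'x) ^ ('l + 'x)" where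
  "edge_matrix p = block_matrix (F_LL p) (F_LX p) (F_XL p) (F_XX p)"

definition noise_cov :: "('l::finite, 'x::finite) params \<Rightarrow> real ^ ('l + 'x) ^ ('l + 'x)" where
  "noise_cov p = block_matrix (Omega_L p) 0 0 (Omega_X p)"

definition total_cov :: "('l::finite, 'x::finite) params \<Rightarrow> real ^ ('l + 'x) ^ ('l + 'x)" where
  "total_cov p = transpose (matrix_inv (mat 1 - edge_matrix p)) ** noise_cov p
     ** matrix_inv (mat 1 - edge_matrix p)"

definition Sigma_X :: "('l::finite, 'x::finite) params \<Rightarrow> real ^ 'x ^ 'x" where
  "Sigma_X p = (\<chi> i j. total_cov p $ Inr i $ Inr j)"

definition diagonal_matrix :: "real ^ 'n ^ 'n \<Rightarrow> bool" where
  "diagonal_matrix A \<longleftrightarrow> (\<forall>i j. i \<noteq> j \<longrightarrow> A $ i $ j = 0)"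

definition compatible :: "('l::finite + 'x::finite) rel \<Rightarrow> ('l, 'x) params \<Rightarrow> bool" where
  "compatible G p \<longleftrightarrow>
     (\<forall>j i. edge_matrix p $ j $ i \<noteq> 0 \<longleftrightarrow> j \<in> parents G i) \<and>
     diagonal_matrix (noise_cov p) \<and> (\<forall>i. 0 < noise_cov p $ i $ i)"

text \<open>
  The noise means \<open>\<mu> i\<close> are left arbitrary; they do not affect any covariance.
  Only the variables \<open>V (Inr _)\<close> are observed.
\<close>

definition partially_observed_linear_causal_model ::
  "('l::finite + 'x::finite) rel \<Rightarrow> ('l, 'x) params \<Rightarrow> 'a measure
    \<Rightarrow> ('l + 'x \<Rightarrow> 'a \<Rightarrow> real) \<Rightarrow> ('l + 'x \<Rightarrow> 'a \<Rightarrow> real) \<Rightarrow> bool" where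
  "partially_observed_linear_causal_model G p M V \<epsilon> \<longleftrightarrow>
     acyclic G \<and> compatible G p \<and> prob_space M \<and>
     prob_space.indep_vars M (\<lambda>_. borel) \<epsilon> UNIV \<and>
     (\<forall>i. \<exists>\<mu>. distributed M lborel (\<epsilon> i) (normal_density \<mu> (sqrt (noise_cov p $ i $ i)))) \<and>
     (\<forall>i. \<forall>\<omega>\<in>space M.
        V i \<omega> = (\<Sum>j\<in>parents G i. edge_matrix p $ j $ i * V j \<omega>) + \<epsilon> i \<omega>)"

definition orthogonal_transform ::
  "real ^ 'l ^ 'l \<Rightarrow> ('l::finite, 'x::finite) params \<Rightarrow> ('l, 'x) params" where
  "orthogonal_transform Q p =
     \<lparr> F_LL = transpose Q ** F_LL p ** Q,
       F_LX = transpose Q ** F_LX p,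
       F_XL = F_XL p ** Q,
       F_XX = F_XX p,
       Omega_L = Omega_L p,
       Omega_X = Omega_X p \<rparr>"

definition same_support :: "real ^ 'n ^ 'm \<Rightarrow> real ^ 'n ^ 'm \<Rightarrow> bool" where
  "same_support A B \<longleftrightarrow> (\<forall>i j. A $ i $ j \<noteq> 0 \<longleftrightarrow> B $ i $ j \<noteq> 0)"

definition same_params_support ::
  "('l::finite, 'x::finite) params \<Rightarrow> ('l, 'x) params \<Rightarrow> bool" where
  "same_params_support p p' \<longleftrightarrow>
     same_support (F_LL p) (F_LL p') \<and> same_support (F_LX p) (F_LX p') \<and>
     same_support (F_XL p) (F_XL p') \<and> same_support (F_XX p) (F_XX p') \<and>
     same_support (Omega_L p) (Omega_L p') \<and> same_support (Omega_X p) (Omega_X p')"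

definition indeterminacy_witness ::
  "real ^ 'l ^ 'l \<Rightarrow> ('l::finite, 'x::finite) params \<Rightarrow> bool" where
  "indeterminacy_witness Q p \<longleftrightarrow>
     orthogonal_matrix Q \<and> \<not> diagonal_matrix Q \<and>
     same_params_support p (orthogonal_transform Q p) \<and>
     Sigma_X (orthogonal_transform Q p) = Sigma_X p"

definition orthogonal_transformation_indeterminacy ::
  "('l::finite, 'x::finite) params \<Rightarrow> bool" where
  "orthogonal_transformation_indeterminacy p \<longleftrightarrow> (\<exists>Q. indeterminacy_witness Q p)"

text \<open>
  The edge coefficients are identified up to the relation \<open>R\<close> if every choice of parameters
  that is compatible with the graph, has unit latent noise covariance, and entails the same
  observations has edge coefficients \<open>R\<close>-related to the given ones.
\<close>

definition identified_up_to ::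
  "('l::finite + 'x::finite) rel \<Rightarrow> ('l, 'x) params
    \<Rightarrow> (real ^ ('l + 'x) ^ ('l + 'x) \<Rightarrow> real ^ ('l + 'x) ^ ('l + 'x) \<Rightarrow> bool) \<Rightarrow> bool" where
  "identified_up_to G p R \<longleftrightarrow>
     (\<forall>p'. compatible G p' \<and> Omega_L p' = mat 1 \<and> Sigma_X p' = Sigma_X p
        \<longrightarrow> R (edge_matrix p) (edge_matrix p'))"

end

(* Two distinct variables a, b of L' have equal parents and children, so by acyclicity they are not
   adjacent and every pair (F i a, F i b), or (F a i, F b i), has both entries zero or both nonzero.
   Mixing coordinates a and b by an orthogonal map then keeps the support of F as soon as it kills
   none of these finitely many nonzero pairs, which a generic angle achieves.  For any orthogonal Q,
   with E = diag(Q, I), the transformation is the conjugation F -> E^T F E, which fixes the noise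
   covariance (as Omega_L = I) and therefore the observed block of the total covariance. *)

theory Submission
  imports Defs
begin

section \<open>Block matrices over a sum index type\<close>

lemma sum_UNIV_Plus:
  "(\<Sum>k\<in>UNIV. f k) = (\<Sum>a\<in>UNIV. f (Inl a)) + (\<Sum>b\<in>UNIV. f (Inr b))"
  for f :: "'l::finite + 'x::finite \<Rightarrow> 'b::comm_monoid_add"
  by (simp add: UNIV_Plus_UNIV[symmetric] sum.Plus del: UNIV_Plus_UNIV)

lemma block_matrix_nth [simp]:
  "block_matrix A B C D $ Inl a $ Inl b = A $ a $ b"
  "block_matrix A B C D $ Inl a $ Inr x = B $ a $ x"
  "block_matrix A B C D $ Inr x $ Inl b = C $ x $ b"
  "block_matrix A B C D $ Inr x $ Inr y = D $ x $ y"
  by (simp_all add: block_matrix_def)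

lemma matrix_eq_blockI:
  fixes S T :: "real ^ ('l::finite + 'x::finite) ^ ('l + 'x)"
  assumes "\<And>a b. S $ Inl a $ Inl b = T $ Inl a $ Inl b"
    and "\<And>a x. S $ Inl a $ Inr x = T $ Inl a $ Inr x"
    and "\<And>x b. S $ Inr x $ Inl b = T $ Inr x $ Inl b"
    and "\<And>x y. S $ Inr x $ Inr y = T $ Inr x $ Inr y"
  shows "S = T"
proof -
  have "S $ i $ j = T $ i $ j" for i j
    using assms by (cases i; cases j) auto
  then show ?thesis by (simp add: vec_eq_iff)
qed

lemma block_matrix_mult:
  "block_matrix A B C D ** block_matrix A' B' C' D' =
   block_matrix (A ** A' + B ** C') (A ** B' + B ** D') (C ** A' + D ** C') (C ** B' + D ** D')"
  by (rule matrix_eq_blockI) (simp_all add: matrix_matrix_mult_def sum_UNIV_Plus)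

lemma transpose_block_matrix:
  "transpose (block_matrix A B C D) =
   block_matrix (transpose A) (transpose C) (transpose B) (transpose D)"
  by (rule matrix_eq_blockI) (simp_all add: transpose_def)

lemma transpose_zero [simp]: "transpose (0 :: real ^ 'n ^ 'm) = 0"
  by (simp add: transpose_def vec_eq_iff)

lemma mat_1_block_matrix: "mat 1 = block_matrix (mat 1) 0 0 (mat 1)"
  by (rule matrix_eq_blockI) (simp_all add: mat_def)

text \<open>Makes blockwise multiplication applicable to \<open>total_cov\<close>, which is not
  defined by blocks.\<close>

lemma block_matrix_cases:
  fixes T :: "real ^ ('l::finite + 'x::finite) ^ ('l + 'x)"
  obtains A B C D where "T = block_matrix A B C D"
proof
  show "T = block_matrix (\<chi> a b. T $ Inl a $ Inl b) (\<chi> a x. T $ Inl a $ Inr x)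
              (\<chi> x b. T $ Inr x $ Inl b) (\<chi> x y. T $ Inr x $ Inr y)"
    by (rule matrix_eq_blockI) simp_all
qed

section \<open>Matrix arithmetic and inverses\<close>

lemma matrix_zero_mult [simp]:
  "(0 :: real ^ 'n ^ 'm) ** (A :: real ^ 'k ^ 'n) = 0"
  "(B :: real ^ 'n ^ 'm) ** (0 :: real ^ 'k ^ 'n) = 0"
  by (simp_all add: matrix_matrix_mult_def vec_eq_iff)

lemma matrix_diff_ldistrib:
  fixes A :: "real ^ 'n ^ 'm"
  shows "A ** (B - C) = A ** B - A ** C"
  by (simp add: matrix_matrix_mult_def vec_eq_iff sum_subtractf right_diff_distrib)

lemma matrix_diff_rdistrib:
  fixes A :: "real ^ 'n ^ 'm"
  shows "(A - B) ** C = A ** C - B ** C"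
  by (simp add: matrix_matrix_mult_def vec_eq_iff sum_subtractf left_diff_distrib)

text \<open>The kernel is trivial: \<open>x = F *v x\<close> expresses each \<open>x $ j\<close>
  through the values at children of \<open>j\<close>, so well-founded induction along the converse
  of \<open>G\<close>, starting from the sinks, forces every coordinate to vanish.\<close>

lemma invertible_mat_1_minus_acyclic:
  fixes F :: "real ^ 'v::finite ^ 'v"
  assumes "acyclic G" and supp: "\<And>j i. F $ j $ i \<noteq> 0 \<Longrightarrow> (j, i) \<in> G"
  shows "invertible (mat 1 - F)"
proof -
  have wf: "wf (G\<inverse>)"
    using \<open>acyclic G\<close> by (simp add: finite_acyclic_wf_converse)
  have "x = 0" if "(mat 1 - F) *v x = 0" for x
  proof -
    have fixpoint: "x $ j = (\<Sum>i\<in>UNIV. F $ j $ i * x $ i)" for j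
    proof -
      have "x = F *v x"
        using that by (simp add: matrix_vector_mult_diff_rdistrib)
      then have "x $ j = (F *v x) $ j"
        by simp
      then show ?thesis
        by (simp only: matrix_vector_mult_def vec_lambda_beta)
    qed
    have "x $ j = 0" for j
    proof (induction j rule: wf_induct_rule[OF wf])
      case (1 j)
      have "F $ j $ i * x $ i = 0" for i
        using 1[of i] supp[of j i] by auto
      then show ?case
        by (subst fixpoint) (blast intro: sum.neutral)
    qed
    then show ?thesis by (simp add: vec_eq_iff)
  qed
  then show ?thesis
    by (simp add: invertible_left_inverse matrix_left_invertible_ker)
qed

lemma matrix_inv_right:
  assumes "invertible A"
  shows "A ** matrix_inv A = mat 1"
  using someI_ex[OF assms[unfolded invertible_def]] unfolding matrix_inv_def by blast

text \<open>A right inverse of a square matrix is also a left inverse, and a two-sided inverse is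
  unique.\<close>

lemma matrix_inv_eqI:
  fixes A B :: "real ^ 'n ^ 'n"
  assumes AB: "A ** B = mat 1"
  shows "matrix_inv A = B"
proof -
  have BA: "B ** A = mat 1"
    using AB by (simp only: matrix_left_right_inverse)
  then have "invertible A"
    using AB by (auto simp: invertible_def)
  have "matrix_inv A = B ** A ** matrix_inv A"
    by (simp add: BA)
  also have "\<dots> = B ** (A ** matrix_inv A)"
    by (simp only: matrix_mul_assoc)
  finally show ?thesis
    by (simp add: matrix_inv_right[OF \<open>invertible A\<close>])
qed

lemma matrix_inv_orthogonal_conjugate:
  fixes A E :: "real ^ 'n ^ 'n"
  assumes "orthogonal_matrix E" "invertible A"
  shows "matrix_inv (transpose E ** A ** E) = transpose E ** matrix_inv A ** E"
proof (rule matrix_inv_eqI)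
  have "transpose E ** A ** E ** (transpose E ** matrix_inv A ** E) =
      transpose E ** (A ** (E ** transpose E) ** matrix_inv A) ** E"
    by (simp add: matrix_mul_assoc)
  also have "\<dots> = mat 1"
    using assms by (simp add: orthogonal_matrix_def matrix_inv_right)
  finally show "transpose E ** A ** E ** (transpose E ** matrix_inv A ** E) = mat 1" .
qed

section \<open>Invariance of the observed covariance\<close>

lemma orthogonal_matrix_block:
  assumes "orthogonal_matrix Q"
  shows "orthogonal_matrix (block_matrix Q 0 0 (mat 1))"
  using assms unfolding mat_1_block_matrix orthogonal_matrix_def
  by (simp add: transpose_block_matrix block_matrix_mult mat_1_block_matrix[symmetric])

text \<open>Packs the blockwise formulas into a single conjugation, so that the inverse of
  \<open>mat 1 - F\<close> can be transformed as a whole.\<close>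

lemma edge_matrix_orthogonal_transform:
  "edge_matrix (orthogonal_transform Q p) =
   transpose (block_matrix Q 0 0 (mat 1)) ** edge_matrix p ** block_matrix Q 0 0 (mat 1)"
  by (simp add: edge_matrix_def orthogonal_transform_def transpose_block_matrix block_matrix_mult)

lemma Sigma_X_orthogonal_transform:
  assumes Q: "orthogonal_matrix Q" and inv: "invertible (mat 1 - edge_matrix p)"
    and "Omega_L p = mat 1"
  shows "Sigma_X (orthogonal_transform Q p) = Sigma_X p"
proof -
  define E :: "real ^ ('a + 'b) ^ ('a + 'b)" where "E = block_matrix Q 0 0 (mat 1)"
  define W where "W = matrix_inv (mat 1 - edge_matrix p)"
  have E: "orthogonal_matrix E"
    using Q by (simp add: E_def orthogonal_matrix_block)
  have "mat 1 - edge_matrix (orthogonal_transform Q p) = transpose E ** (mat 1 - edge_matrix p) ** E"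
    using E by (simp add: edge_matrix_orthogonal_transform E_def[symmetric] orthogonal_matrix_def
        matrix_diff_ldistrib matrix_diff_rdistrib)
  then have W': "matrix_inv (mat 1 - edge_matrix (orthogonal_transform Q p)) = transpose E ** W ** E"
    using E inv by (simp add: W_def matrix_inv_orthogonal_conjugate)
  have noise: "noise_cov (orthogonal_transform Q p) = noise_cov p"
    by (simp add: noise_cov_def orthogonal_transform_def)
  \<comment> \<open>The latent block becomes \<open>Q ** transpose Q\<close>, which is the identity
    again because the latent noise covariance is.\<close>
  have noise_conj: "E ** noise_cov p ** transpose E = noise_cov p"
    using Q \<open>Omega_L p = mat 1\<close>
    by (simp add: E_def noise_cov_def transpose_block_matrix block_matrix_mult orthogonal_matrix_def)
  have "total_cov (orthogonal_transform Q p) =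
      transpose E ** transpose W ** (E ** noise_cov p ** transpose E) ** W ** E"
    by (simp add: total_cov_def W' noise matrix_transpose_mul matrix_mul_assoc)
  also have "\<dots> = transpose E ** total_cov p ** E"
    by (simp only: noise_conj total_cov_def W_def matrix_mul_assoc)
  finally have total: "total_cov (orthogonal_transform Q p) = transpose E ** total_cov p ** E" .
  \<comment> \<open>\<open>E\<close> is the identity on observed coordinates, so conjugation by it
    leaves the block \<open>D\<close> alone.\<close>
  obtain A B C D where "total_cov p = block_matrix A B C D"
    by (rule block_matrix_cases)
  then show ?thesis
    by (simp add: Sigma_X_def total E_def transpose_block_matrix block_matrix_mult)
qed

section \<open>Reflections in a coordinate plane\<close>

text \<open>For \<open>a \<noteq> b\<close> and \<open>c\<^sup>2 + s\<^sup>2 = 1\<close> this is a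
  reflection of the plane of coordinates \<open>a\<close> and \<open>b\<close>. Unlike a rotation it
  is symmetric, so \<open>transpose Q\<close> is again \<open>Q\<close> and left multiplication
  reduces to right multiplication.\<close>

definition plane_reflection :: "'l \<Rightarrow> 'l \<Rightarrow> real \<Rightarrow> real \<Rightarrow> real ^ 'l ^ 'l::finite" where
  "plane_reflection a b c s = (\<chi> i j.
     if j = a then (if i = a then c else if i = b then s else 0)
     else if j = b then (if i = a then s else if i = b then - c else 0)
     else if i = j then 1 else 0)"

lemma transpose_plane_reflection:
  "transpose (plane_reflection a b c s) = plane_reflection a b c s"
  by (auto simp: transpose_def plane_reflection_def vec_eq_iff)

lemma mult_plane_reflection_nth:
  fixes A :: "real ^ 'l::finite ^ 'm::finite"
  assumes "a \<noteq> b"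
  shows "(A ** plane_reflection a b c s) $ i $ j =
    (if j = a then c * A $ i $ a + s * A $ i $ b
     else if j = b then s * A $ i $ a - c * A $ i $ b else A $ i $ j)"
proof -
  \<comment> \<open>General \<open>u\<close>, \<open>v\<close> cover both mixed columns:
    \<open>(c, s)\<close> for column \<open>a\<close> and \<open>(s, -c)\<close> for column
    \<open>b\<close>.\<close>
  have "(\<Sum>k\<in>UNIV. A $ i $ k * (if k = a then u else if k = b then v else 0)) =
      u * A $ i $ a + v * A $ i $ b" for u v
  proof -
    have "(\<Sum>k\<in>UNIV. A $ i $ k * (if k = a then u else if k = b then v else 0)) =
        (\<Sum>k\<in>UNIV. (if k = a then u * A $ i $ a else 0) + (if k = b then v * A $ i $ b else 0))"
      using assms by (intro sum.cong) auto
    then show ?thesis by (simp add: sum.distrib)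
  qed
  moreover have "(\<Sum>k\<in>UNIV. A $ i $ k * (if k = j then 1 else 0)) = A $ i $ j"
    by (simp add: if_distrib cong: if_cong)
  ultimately show ?thesis
    by (simp add: matrix_matrix_mult_def plane_reflection_def)
qed

text \<open>A symmetric involution is orthogonal.\<close>

lemma orthogonal_plane_reflection:
  assumes "a \<noteq> b" "c\<^sup>2 + s\<^sup>2 = 1"
  shows "orthogonal_matrix (plane_reflection a b c s)"
proof -
  have "c * c + s * s = 1" "s * s + c * c = 1"
    using assms(2) by (simp_all add: power2_eq_square)
  then have "plane_reflection a b c s ** plane_reflection a b c s = mat 1"
    using assms(1)
    by (auto simp: vec_eq_iff mult_plane_reflection_nth)
      (auto simp: plane_reflection_def mat_def)
  then show ?thesis
    by (simp add: orthogonal_matrix_def transpose_plane_reflection)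
qed

text \<open>Take \<open>(c, s)\<close> proportional to \<open>(1, t)\<close>. A pair with both
  entries nonzero is killed only by the slopes \<open>- x / y\<close> and \<open>y / x\<close>, and
  a zero pair stays zero. Finitely many slopes are excluded, so some real \<open>t\<close>
  remains.\<close>

lemma exists_generic_direction:
  fixes P :: "(real \<times> real) set"
  assumes "finite P" and P: "\<And>x y. (x, y) \<in> P \<Longrightarrow> x \<noteq> 0 \<longleftrightarrow> y \<noteq> 0"
  obtains c s where "c\<^sup>2 + s\<^sup>2 = 1" "s \<noteq> 0"
    and "\<And>x y. (x, y) \<in> P \<Longrightarrow> c * x + s * y \<noteq> 0 \<longleftrightarrow> x \<noteq> 0"
    and "\<And>x y. (x, y) \<in> P \<Longrightarrow> s * x - c * y \<noteq> 0 \<longleftrightarrow> y \<noteq> 0"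
proof -
  \<comment> \<open>Excluding 0 gives \<open>s \<noteq> 0\<close>, which later makes the reflection
    non-diagonal. Zero pairs contribute only \<open>0 / 0 = 0\<close>.\<close>
  define bad where "bad = insert 0 ((\<lambda>(x, y). - x / y) ` P \<union> (\<lambda>(x, y). y / x) ` P)"
  have "finite bad" using \<open>finite P\<close> by (simp add: bad_def)
  then obtain t where t: "t \<notin> bad"
    using ex_new_if_finite infinite_UNIV_char_0 by blast
  define r where "r = sqrt (1 + t\<^sup>2)"
  have r2: "r\<^sup>2 = 1 + t\<^sup>2" by (simp add: r_def)
  have "r > 0" by (simp add: r_def add_pos_nonneg)
  show thesis
  proof
    show "(1 / r)\<^sup>2 + (t / r)\<^sup>2 = 1"
      using \<open>r > 0\<close> r2[symmetric] by (simp add: power_divide add_divide_distrib[symmetric])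
    show "t / r \<noteq> 0"
      using t \<open>r > 0\<close> by (auto simp: bad_def)
    fix x y assume xy: "(x, y) \<in> P"
    have 1: "t \<noteq> - x / y" and 2: "t \<noteq> y / x"
      using t xy by (force simp: bad_def)+
    have "x + t * y \<noteq> 0 \<longleftrightarrow> x \<noteq> 0"
      using P[OF xy] 1 by (auto simp: field_simps)
    moreover have "1 / r * x + t / r * y = (x + t * y) / r"
      by (simp add: add_divide_distrib)
    ultimately show "1 / r * x + t / r * y \<noteq> 0 \<longleftrightarrow> x \<noteq> 0"
      using \<open>r > 0\<close> by simp
    have "t * x - y \<noteq> 0 \<longleftrightarrow> y \<noteq> 0"
      using P[OF xy] 2 by (auto simp: field_simps)
    moreover have "t / r * x - 1 / r * y = (t * x - y) / r"
      by (simp add: diff_divide_distrib)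
    ultimately show "t / r * x - 1 / r * y \<noteq> 0 \<longleftrightarrow> y \<noteq> 0"
      using \<open>r > 0\<close> by simp
  qed
qed

section \<open>Preservation of supports\<close>

lemma same_support_mult_plane_reflection:
  fixes A :: "real ^ 'l::finite ^ 'm::finite"
  assumes "a \<noteq> b"
    and "\<And>i. c * A $ i $ a + s * A $ i $ b \<noteq> 0 \<longleftrightarrow> A $ i $ a \<noteq> 0"
    and "\<And>i. s * A $ i $ a - c * A $ i $ b \<noteq> 0 \<longleftrightarrow> A $ i $ b \<noteq> 0"
  shows "same_support A (A ** plane_reflection a b c s)"
  using assms(2,3) by (simp add: same_support_def mult_plane_reflection_nth[OF \<open>a \<noteq> b\<close>])

lemma same_support_transpose:
  "same_support (transpose A) (transpose B) \<longleftrightarrow> same_support A B"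
  by (auto simp: same_support_def transpose_def)

text \<open>Transposition turns this into the right-hand case, the reflection being
  symmetric.\<close>

lemma same_support_plane_reflection_mult:
  fixes A :: "real ^ 'm::finite ^ 'l::finite"
  assumes "a \<noteq> b"
    and "\<And>j. c * A $ a $ j + s * A $ b $ j \<noteq> 0 \<longleftrightarrow> A $ a $ j \<noteq> 0"
    and "\<And>j. s * A $ a $ j - c * A $ b $ j \<noteq> 0 \<longleftrightarrow> A $ b $ j \<noteq> 0"
  shows "same_support A (plane_reflection a b c s ** A)"
proof -
  have "same_support (transpose A) (transpose A ** plane_reflection a b c s)"
    using assms by (intro same_support_mult_plane_reflection) (simp_all add: transpose_def)
  also have "transpose A ** plane_reflection a b c s = transpose (plane_reflection a b c s ** A)"
    by (simp add: matrix_transpose_mul transpose_plane_reflection)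
  finally show ?thesis
    by (simp only: same_support_transpose)
qed

lemma edge_matrix_same_support:
  assumes "same_params_support p p'"
  shows "edge_matrix p' $ j $ i \<noteq> 0 \<longleftrightarrow> edge_matrix p $ j $ i \<noteq> 0"
  using assms unfolding same_params_support_def same_support_def edge_matrix_def
  by (cases i; cases j) simp_all

lemma exists_support_preserving_reflection:
  fixes p :: "('l::finite, 'x::finite) params"
  assumes "a \<noteq> b"
    and rows: "\<And>i. edge_matrix p $ Inl a $ i \<noteq> 0 \<longleftrightarrow> edge_matrix p $ Inl b $ i \<noteq> 0"
    and cols: "\<And>j. edge_matrix p $ j $ Inl a \<noteq> 0 \<longleftrightarrow> edge_matrix p $ j $ Inl b \<noteq> 0"
    and loop: "edge_matrix p $ Inl a $ Inl a = 0"
  obtains Q where "orthogonal_matrix Q" "\<not> diagonal_matrix Q"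
    "same_params_support p (orthogonal_transform Q p)"
proof -
  \<comment> \<open>Row pairs and column pairs are collected together, so that one angle is generic
    for both the left and the right multiplication.\<close>
  define P where "P = range (\<lambda>i. (edge_matrix p $ Inl a $ i, edge_matrix p $ Inl b $ i)) \<union>
                      range (\<lambda>j. (edge_matrix p $ j $ Inl a, edge_matrix p $ j $ Inl b))"
  have "finite P" by (simp add: P_def)
  moreover have "x \<noteq> 0 \<longleftrightarrow> y \<noteq> 0" if "(x, y) \<in> P" for x y
    using that rows cols by (force simp: P_def)
  ultimately obtain c s where cs: "c\<^sup>2 + s\<^sup>2 = 1" "s \<noteq> 0"
    and gen: "\<And>x y. (x, y) \<in> P \<Longrightarrow> c * x + s * y \<noteq> 0 \<longleftrightarrow> x \<noteq> 0"
      "\<And>x y. (x, y) \<in> P \<Longrightarrow> s * x - c * y \<noteq> 0 \<longleftrightarrow> y \<noteq> 0"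
    using exists_generic_direction[of P] by metis
  define Q where "Q = plane_reflection a b c s"
  have row_P: "(edge_matrix p $ Inl a $ i, edge_matrix p $ Inl b $ i) \<in> P"
    and col_P: "(edge_matrix p $ j $ Inl a, edge_matrix p $ j $ Inl b) \<in> P" for i j
    by (auto simp: P_def)
  note row_gen = gen[OF row_P] and col_gen = gen[OF col_P]
  \<comment> \<open>The zero at \<open>(a, a)\<close> spreads: \<open>rows\<close> and
    \<open>cols\<close> carry it to \<open>(b, a)\<close> and \<open>(a, b)\<close>, and from there
    to \<open>(b, b)\<close>.\<close>
  have LL0: "F_LL p $ a $ a = 0" "F_LL p $ a $ b = 0" "F_LL p $ b $ a = 0" "F_LL p $ b $ b = 0"
    using loop rows[of "Inl a"] rows[of "Inl b"] cols[of "Inl a"] cols[of "Inl b"]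
    by (auto simp: edge_matrix_def)
  have LX: "same_support (F_LX p) (Q ** F_LX p)"
    unfolding Q_def using \<open>a \<noteq> b\<close> row_gen(1)[of "Inr _"] row_gen(2)[of "Inr _"]
    by (intro same_support_plane_reflection_mult) (simp_all add: edge_matrix_def)
  have XL: "same_support (F_XL p) (F_XL p ** Q)"
    unfolding Q_def using \<open>a \<noteq> b\<close> col_gen(1)[of "Inr _"] col_gen(2)[of "Inr _"]
    by (intro same_support_mult_plane_reflection) (simp_all add: edge_matrix_def)
  have LL_right: "same_support (F_LL p) (F_LL p ** Q)"
    unfolding Q_def using \<open>a \<noteq> b\<close> col_gen(1)[of "Inl _"] col_gen(2)[of "Inl _"]
    by (intro same_support_mult_plane_reflection) (simp_all add: edge_matrix_def)
  \<comment> \<open>The {a, b} block of \<open>F_LL\<close> vanishes, so right multiplication by \<open>Q\<close> does not touch rows a and b.\<close>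
  have "(F_LL p ** Q) $ a $ j = F_LL p $ a $ j" "(F_LL p ** Q) $ b $ j = F_LL p $ b $ j" for j
    using \<open>a \<noteq> b\<close> LL0 by (simp_all add: Q_def mult_plane_reflection_nth)
  then have "same_support (F_LL p ** Q) (Q ** (F_LL p ** Q))"
    unfolding Q_def using \<open>a \<noteq> b\<close> row_gen(1)[of "Inl _"] row_gen(2)[of "Inl _"]
    by (intro same_support_plane_reflection_mult) (simp_all add: edge_matrix_def)
  with LL_right have LL: "same_support (F_LL p) (Q ** F_LL p ** Q)"
    by (simp add: same_support_def matrix_mul_assoc)
  have "transpose Q = Q"
    by (simp add: Q_def transpose_plane_reflection)
  then have "same_params_support p (orthogonal_transform Q p)"
    using LL LX XL
    by (simp add: same_params_support_def orthogonal_transform_def) (simp add: same_support_def)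
  moreover have "Q $ a $ b = s"
    using \<open>a \<noteq> b\<close> by (simp add: Q_def plane_reflection_def)
  then have "\<not> diagonal_matrix Q"
    using \<open>a \<noteq> b\<close> \<open>s \<noteq> 0\<close> by (auto simp: diagonal_matrix_def)
  moreover have "orthogonal_matrix Q"
    using \<open>a \<noteq> b\<close> cs(1) by (simp add: Q_def orthogonal_plane_reflection)
  ultimately show thesis using that by blast
qed

section \<open>Latent variables with equal parents and children\<close>

theorem theorem4:
  fixes G :: "('l::finite + 'x::finite) rel"
    and p :: "('l, 'x) params"
    and M :: "'a measure"
    and V \<epsilon> :: "'l + 'x \<Rightarrow> 'a \<Rightarrow> real"
    and L' :: "'l set"
  assumes "partially_observed_linear_causal_model G p M V \<epsilon>"
    and "Omega_L p = mat 1"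
    and "card L' \<ge> 2"
    and "\<forall>a\<in>L'. \<forall>b\<in>L'. parents G (Inl a) = parents G (Inl b) \<and>
           children G (Inl a) = children G (Inl b)"
  shows "orthogonal_transformation_indeterminacy p \<and>
    (\<forall>R. identified_up_to G p R \<longrightarrow>
      (\<forall>Q. indeterminacy_witness Q p \<longrightarrow>
        R (edge_matrix p) (edge_matrix (orthogonal_transform Q p))))"
proof
  have "acyclic G" and comp: "compatible G p"
    using assms(1) by (simp_all add: partially_observed_linear_causal_model_def)
  have edge: "edge_matrix p $ j $ i \<noteq> 0 \<longleftrightarrow> (j, i) \<in> G" for j i
    using comp by (simp add: compatible_def parents_def)
  have "\<not> card L' \<le> Suc 0"
    using assms(3) by simp
  then obtain a b where ab: "a \<in> L'" "b \<in> L'" "a \<noteq> b"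
    using card_le_Suc0_iff_eq[of L'] by auto
  then have same: "parents G (Inl a) = parents G (Inl b)" "children G (Inl a) = children G (Inl b)"
    using assms(4) by blast+
  \<comment> \<open>Acyclicity excludes self-loops; equality of parents and children then excludes
    edges between \<open>a\<close> and \<open>b\<close> as well.\<close>
  have "(Inl a, Inl a) \<notin> G"
    using \<open>acyclic G\<close> by (auto simp: acyclic_def)
  with edge have loop: "edge_matrix p $ Inl a $ Inl a = 0"
    by blast
  have rows: "edge_matrix p $ Inl a $ i \<noteq> 0 \<longleftrightarrow> edge_matrix p $ Inl b $ i \<noteq> 0" for i
    using same(2) unfolding edge children_def by blast
  have cols: "edge_matrix p $ j $ Inl a \<noteq> 0 \<longleftrightarrow> edge_matrix p $ j $ Inl b \<noteq> 0" for j
    using same(1) unfolding edge parents_def by blast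
  obtain Q where Q: "orthogonal_matrix Q" "\<not> diagonal_matrix Q"
    "same_params_support p (orthogonal_transform Q p)"
    using exists_support_preserving_reflection[OF ab(3) rows cols loop] .
  have "invertible (mat 1 - edge_matrix p)"
    using \<open>acyclic G\<close> edge by (rule invertible_mat_1_minus_acyclic[OF _ iffD1])
  with Q assms(2) show "orthogonal_transformation_indeterminacy p"
    unfolding orthogonal_transformation_indeterminacy_def indeterminacy_witness_def
    using Sigma_X_orthogonal_transform by blast

  \<comment> \<open>The transformed parameters are themselves a competitor in
    \<open>identified_up_to\<close>: equal supports and unchanged noise keep them compatible with
    \<open>G\<close>, the latent noise stays the identity, and the witness preserves
    \<open>Sigma_X\<close>. Hence no valid \<open>R\<close> can separate them from
    \<open>p\<close>.\<close>
  show "\<forall>R. identified_up_to G p R \<longrightarrow>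
      (\<forall>Q. indeterminacy_witness Q p \<longrightarrow>
        R (edge_matrix p) (edge_matrix (orthogonal_transform Q p)))"
  proof (intro allI impI)
    fix R Q
    assume R: "identified_up_to G p R" and Q: "indeterminacy_witness Q p"
    have "compatible G (orthogonal_transform Q p)"
      using Q comp edge_matrix_same_support[of p "orthogonal_transform Q p"]
      by (simp add: indeterminacy_witness_def compatible_def noise_cov_def orthogonal_transform_def)
    moreover have "Omega_L (orthogonal_transform Q p) = mat 1"
      using assms(2) by (simp add: orthogonal_transform_def)
    ultimately show "R (edge_matrix p) (edge_matrix (orthogonal_transform Q p))"
      using R Q by (auto simp: identified_up_to_def indeterminacy_witness_def)
  qed
qed

end
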